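(* The offline dynamic regret $\mathbf{Reg}_T$ cannot be sublinear in $T$ unless the squared path length $\mathcal{S}_T$ is sublinear, in the following sense: there exists a sequence of functions $\{(U_t,g_t)\}_{t=1}^T$ with linear $\mathcal{S}_T$ for which no policy can have a sublinear regret. Such a sequence is constructed in the scalar case as follows. Let $\{w(t)\}_{t=1}^T$ be parameters with $w(t)\in[-W,W]$, where $w(t)$ is revealed by the adversary after the action $x(t)$ has been taken, and let $$U_t(x(t))=-\tfrac12\,(x(t)-w(t))^2,\qquad g_t(x,x')=|x-x'|^2-4W^2 .$$ For this choice: (i) if $x(t)\in[-W,W]$ for all $t$, the constraint $g_t(x(t),x(t+1))\le 0$ is always satisfied; (ii) the optimal offline solution is $x^\star(t)=w(t)$, and hence $$\mathcal{S}_T=\mathcal{G}_T=\sum_{t=1}^{T-1}(w(t+1)-w(t))^2\le 4W^2T;$$ (iii) the regret is $\mathbf{Reg}_T=\tfrac12\sum_{t=1}^T (x(t)-w(t))^2$; (iv) if the adversary chooses $w(t)=-W\,\mathrm{sign}(x(t))$ (with $\mathrm{sign}(0):=1$), then, irrespective of the policy $x(t)$ used, $$\mathbf{Reg}_T=\tfrac12\sum_{t=1}^T\big(x^2(t)+W^2+2W|x(t)|\big)\ \ge\ \frac{W^2}{2}\,T .$$ Therefore, for a constant $W$ (e.g. $W=1$), it is possible to have functions $\{(U_t,g_t)\}_t$ for which the regret is linear in $T$ if no other restrictions are imposed on the squared path length. On the other hand, for $W=T^{-\gamma}$ with $\gamma>0$, the regret is at least of order $T^{1-2\gamma}$, which is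 lower than the upper bound $\mathcal{O}(T^{1-\gamma})$ obtainable using online gradient ascent (OGA). This gap suggests that there may exist online algorithms that improve upon the OGA regret rate $\mathcal{O}\big(\sqrt{T(\mathcal{S}_T+\mathcal{G}_T)}\big)$.
   Context: Offline problem: given concave utilities $U_t$, convex coupling constraint functions $g_t$, a nonempty closed convex set $\mathcal{X}$ and a starting point $s$, maximize $\sum_{t=1}^T U_t(x(t))$ over $x(1),\dots,x(T)$ subject to $g_t(x(t),x(t+1))\le 0$ for $1\le t\le T-1$, $x(1)=s$, and $x(t)\in\mathcal{X}$ for $1\le t\le T$. Its solution is denoted $\{x^\star(t)\}_{t=1}^T$. Online policy: at each time the action $x(t)$ is chosen using only information available before $(U_t,g_t)$ is revealed; the adversary may choose $(U_t,g_t)$ after seeing $x(t)$. Offline dynamic regret: $\mathbf{Reg}_T:=\sum_{t=1}^T U_t(x^\star(t))-\sum_{t=1}^T U_t(x(t))$, where $x(t)$ are the actions of the online policy. Squared path length: $\mathcal{S}_T:=\sum_{t=1}^{T-1}\|x^\star(t+1)-x^\star(t)\|^2$. Squared cumulative gradient variation: $\mathcal{G}_T:=\sum_{t=1}^{T-1}\max_{x\in\mathcal{X}}\|\nabla U_{t+1}(x)-\nabla U_t(x)\|^2$. OGA: the iteration $x(t+1)=P_{\mathcal{X}}\big(x(t)+\tfrac{1}{a(t)}\nabla U_t(x(t))\big)$ with $x(1)=s$, where $P_{\mathcal{X}}$ is projection onto $\mathcal{X}$ and $1/a(t)$ is the step size. Its regret bound is $\mathbf{Reg}_T=\mathcal{O}\big(\sqrt{T(\mathcal{S}_T+\mathcal{G}_T)}\big)$,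 when every $U_t$ is strongly concave with a common parameter, has $L$-Lipschitz gradient, and has uniformly bounded gradients, the iterates satisfy the constraints $g_t(x(t),x(t+1))\le0$, and $\max_t a(t)<2\min_t a(t)-L$.
   Formalization: Claims (ii)–(iv) fail if s ≠ w(1), so they are stated for s = w(1) and X ⊇ [−W,W], with corrected forms for a shared start; as the sign rule can give S_T = 0, the linear-S_T claim is for some adaptive adversary with the same U_t, g_t and W = 1. *)

theory Defs
  imports "HOL-Analysis.Analysis" "HOL-Library.Landau_Symbols"
begin

text \<open>Time indices start at 1; the values of a sequence outside \<open>{1..T}\<close> are irrelevant,
  except that \<open>x 1 = s\<close> is required also for the degenerate horizon \<open>T = 0\<close>.\<close>

definition decision_set :: "'a::euclidean_space set \<Rightarrow> bool" where
  "decision_set X \<longleftrightarrow> X \<noteq> {} \<and> closed X \<and> convex X"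

definition offline_feasible ::
  "'a set \<Rightarrow> 'a \<Rightarrow> (nat \<Rightarrow> 'a \<Rightarrow> 'a \<Rightarrow> real) \<Rightarrow> nat \<Rightarrow> (nat \<Rightarrow> 'a) \<Rightarrow> bool" where
  "offline_feasible X s g T x \<longleftrightarrow>
     x 1 = s \<and> (\<forall>t\<in>{1..T}. x t \<in> X) \<and> (\<forall>t\<in>{1..<T}. g t (x t) (x (t + 1)) \<le> 0)"

definition offline_solution ::
  "'a set \<Rightarrow> 'a \<Rightarrow> (nat \<Rightarrow> 'a \<Rightarrow> real) \<Rightarrow> (nat \<Rightarrow> 'a \<Rightarrow> 'a \<Rightarrow> real) \<Rightarrow> nat \<Rightarrow> (nat \<Rightarrow> 'a) \<Rightarrow> bool"
  where
  "offline_solution X s U g T xs \<longleftrightarrow>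
     is_arg_max (\<lambda>x. \<Sum>t=1..T. U t (x t)) (offline_feasible X s g T) xs"

definition regret :: "nat \<Rightarrow> (nat \<Rightarrow> 'a \<Rightarrow> real) \<Rightarrow> (nat \<Rightarrow> 'a) \<Rightarrow> (nat \<Rightarrow> 'a) \<Rightarrow> real" where
  "regret T U xs x = (\<Sum>t=1..T. U t (xs t)) - (\<Sum>t=1..T. U t (x t))"

definition sq_path_length :: "nat \<Rightarrow> (nat \<Rightarrow> 'a::real_normed_vector) \<Rightarrow> real" where
  "sq_path_length T xs = (\<Sum>t=1..<T. (norm (xs (t + 1) - xs t))\<^sup>2)"

definition gradient :: "('a::real_inner \<Rightarrow> real) \<Rightarrow> 'a \<Rightarrow> 'a" where
  "gradient f x = (THE D. GDERIV f x :> D)"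

text \<open>The maximum over \<open>X\<close> is rendered as a supremum; on the reals this is meaningful only when the
  gradient differences are bounded on \<open>X\<close> (in the scalar construction they are constant).\<close>

definition sq_grad_variation :: "'a::euclidean_space set \<Rightarrow> nat \<Rightarrow> (nat \<Rightarrow> 'a \<Rightarrow> real) \<Rightarrow> real" where
  "sq_grad_variation X T U =
     (\<Sum>t=1..<T. SUP x\<in>X. (norm (gradient (U (t + 1)) x - gradient (U t) x))\<^sup>2)"

text \<open>A policy maps the list of pairs revealed so far, \<open>(U\<^sub>1, g\<^sub>1), \<dots>, (U\<^sub>t\<^sub>-\<^sub>1, g\<^sub>t\<^sub>-\<^sub>1)\<close>, to the
  action at time \<open>t\<close>; its own earlier actions are determined by the same information.
  The adversary sees all actions up to and including the one at time \<open>t\<close>, in chronological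
  order, before it commits to \<open>(U\<^sub>t, g\<^sub>t)\<close>.\<close>

type_synonym 'a stage = "('a \<Rightarrow> real) \<times> ('a \<Rightarrow> 'a \<Rightarrow> real)"
type_synonym 'a policy = "'a stage list \<Rightarrow> 'a"
type_synonym 'a adversary = "'a list \<Rightarrow> 'a stage"

primrec play :: "'a policy \<Rightarrow> 'a adversary \<Rightarrow> nat \<Rightarrow> 'a list \<times> 'a stage list" where
  "play p A 0 = ([], [])"
| "play p A (Suc t) =
     (let (xs, fs) = play p A t; xs' = xs @ [p fs] in (xs', fs @ [A xs']))"

definition action :: "'a policy \<Rightarrow> 'a adversary \<Rightarrow> nat \<Rightarrow> 'a" where
  "action p A t = last (fst (play p A t))"

definition revealed_U :: "'a policy \<Rightarrow> 'a adversary \<Rightarrow> nat \<Rightarrow> 'a \<Rightarrow> real" where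
  "revealed_U p A t = fst (last (snd (play p A t)))"

definition revealed_g :: "'a policy \<Rightarrow> 'a adversary \<Rightarrow> nat \<Rightarrow> 'a \<Rightarrow> 'a \<Rightarrow> real" where
  "revealed_g p A t = snd (last (snd (play p A t)))"

definition oga_iterates ::
  "'a::euclidean_space set \<Rightarrow> 'a \<Rightarrow> (nat \<Rightarrow> real) \<Rightarrow> (nat \<Rightarrow> 'a \<Rightarrow> real) \<Rightarrow> nat \<Rightarrow> (nat \<Rightarrow> 'a) \<Rightarrow> bool"
  where
  "oga_iterates X s a U T x \<longleftrightarrow> x 1 = s \<and>
     (\<forall>t\<in>{1..<T}. x (t + 1) = closest_point X (x t + (1 / a t) *\<^sub>R gradient (U t) (x t)))"

definition strongly_concave_on :: "'a::real_inner set \<Rightarrow> real \<Rightarrow> ('a \<Rightarrow> real) \<Rightarrow> bool" where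
  "strongly_concave_on X m f \<longleftrightarrow> concave_on X (\<lambda>x. f x + m / 2 * (norm x)\<^sup>2)"

definition oga_step_condition :: "(nat \<Rightarrow> real) \<Rightarrow> real \<Rightarrow> nat \<Rightarrow> bool" where
  "oga_step_condition a L T \<longleftrightarrow> Max (a ` {1..T}) < 2 * Min (a ` {1..T}) - L"

text \<open>The hypotheses under which the regret bound of online gradient ascent is available, with
  strong concavity parameter \<open>m\<close>, smoothness constant \<open>L\<close> and gradient bound \<open>B\<close>.\<close>

definition oga_regime ::
  "'a::euclidean_space set \<Rightarrow> (nat \<Rightarrow> 'a \<Rightarrow> real) \<Rightarrow> (nat \<Rightarrow> 'a \<Rightarrow> 'a \<Rightarrow> real) \<Rightarrow> nat \<Rightarrow>
     real \<Rightarrow> real \<Rightarrow> real \<Rightarrow> (nat \<Rightarrow> real) \<Rightarrow> (nat \<Rightarrow> 'a) \<Rightarrow> bool" where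
  "oga_regime X U g T m L B a x \<longleftrightarrow>
     0 < m \<and>
     (\<forall>t\<in>{1..T}. strongly_concave_on X m (U t)
        \<and> (\<forall>y\<in>X. GDERIV (U t) y :> gradient (U t) y)
        \<and> L-lipschitz_on X (gradient (U t))
        \<and> (\<forall>y\<in>X. norm (gradient (U t) y) \<le> B)) \<and>
     (\<forall>t\<in>{1..<T}. g t (x t) (x (t + 1)) \<le> 0) \<and>
     oga_step_condition a L T"

definition scalar_U :: "real \<Rightarrow> real \<Rightarrow> real" where
  "scalar_U w x = - (1 / 2) * (x - w)\<^sup>2"

definition scalar_g :: "real \<Rightarrow> real \<Rightarrow> real \<Rightarrow> real" where
  "scalar_g W x x' = \<bar>x - x'\<bar>\<^sup>2 - 4 * W\<^sup>2"

text \<open>Unlike \<^const>\<open>sgn\<close>, this takes the value 1 at 0.\<close>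

definition sign1 :: "real \<Rightarrow> real" where
  "sign1 x = (if x = 0 then 1 else sgn x)"

definition sign_adversary :: "real \<Rightarrow> real adversary" where
  "sign_adversary W h = (scalar_U (- W * sign1 (last h)), scalar_g W)"

end

theory Submission
  imports Defs "HOL-Real_Asymp.Real_Asymp"
begin

text \<open>Against the quadratic utilities \<open>U\<^sub>t(x) = - (x - w\<^sub>t)\<^sup>2 / 2\<close> the coupling constraint never binds on
  \<open>[-W, W]\<close>, so the offline optimum tracks \<open>w\<close> exactly after the prescribed starting point, and the
  regret is half the squared tracking error. An adversary that places \<open>w\<^sub>t\<close> on the opposite side of the
  action makes each error at least \<open>W\<close>; playing \<open>0\<close> at odd and \<open>- sign1 x\<^sub>t\<close> at even times makes in
  addition every step of the offline path have length one.

  For the upper bound, gradient ascent contracts the distance to the current target by a factor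
  \<open>\<rho> < 1\<close>, since the step condition confines all \<open>a(t)\<close> to a bounded interval above 1. Hence
  \<open>e\<^sub>t\<^sub>+\<^sub>1 \<le> \<rho> e\<^sub>t + \<bar>w\<^sub>t\<^sub>+\<^sub>1 - w\<^sub>t\<bar>\<close> and the regret is even \<open>O(S\<^sub>T + G\<^sub>T)\<close>; as
  \<open>S\<^sub>T + G\<^sub>T \<le> 8 T\<close>, this is \<open>O(sqrt (T (S\<^sub>T + G\<^sub>T)))\<close>.\<close>

section \<open>Convexity and gradients of the scalar utilities and constraints\<close>

lemma square_convex_comb:
  fixes a b u v :: real
  assumes "0 \<le> u" "0 \<le> v" "u + v = 1"
  shows "(u * a + v * b)\<^sup>2 \<le> u * a\<^sup>2 + v * b\<^sup>2"
proof -
  have u: "u = 1 - v" using assms by simp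
  \<comment> \<open>The gap in the inequality is the variance of the two-point distribution with
    weights \<open>u\<close> and \<open>v\<close>.\<close>
  have "u * a\<^sup>2 + v * b\<^sup>2 - (u * a + v * b)\<^sup>2 = u * v * (a - b)\<^sup>2"
    unfolding u by (simp add: power2_eq_square algebra_simps)
  moreover have "0 \<le> u * v * (a - b)\<^sup>2" using assms by simp
  ultimately show ?thesis by linarith
qed

lemma concave_on_scalar_U:
  assumes "convex S"
  shows "concave_on S (scalar_U w)"
  unfolding concave_on_def convex_on_def
proof (intro conjI ballI allI impI)
  fix x y u v :: real
  assume uv: "0 \<le> u" "0 \<le> v" "u + v = 1"
  have "u * x + v * y - w = u * (x - w) + v * (y - w)"
    using arg_cong[OF uv(3), of "\<lambda>r. r * w"] by (simp add: algebra_simps)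
  then show "- scalar_U w (u *\<^sub>R x + v *\<^sub>R y) \<le> u * - scalar_U w x + v * - scalar_U w y"
    using square_convex_comb[OF uv, of "x - w" "y - w"] by (simp add: scalar_U_def)
qed (use assms in simp)

lemma convex_on_scalar_g:
  assumes "convex S"
  shows "convex_on S (\<lambda>(x, x'). scalar_g W x x')"
  unfolding convex_on_def
proof (intro conjI ballI allI impI)
  fix x y :: "real \<times> real" and u v :: real
  assume uv: "0 \<le> u" "0 \<le> v" "u + v = 1"
  obtain a b where x: "x = (a, b)" by (cases x)
  obtain c d where y: "y = (c, d)" by (cases y)
  have "u * a + v * c - (u * b + v * d) = u * (a - b) + v * (c - d)"
    by (simp add: algebra_simps)
  moreover have "u * (4 * W\<^sup>2) + v * (4 * W\<^sup>2) = 4 * W\<^sup>2"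
    by (simp add: uv(3) flip: distrib_right)
  moreover have "u * ((a - b)\<^sup>2 - 4 * W\<^sup>2) + v * ((c - d)\<^sup>2 - 4 * W\<^sup>2)
      = u * (a - b)\<^sup>2 + v * (c - d)\<^sup>2 - (u * (4 * W\<^sup>2) + v * (4 * W\<^sup>2))"
    by (simp only: right_diff_distrib)
  ultimately show "(case u *\<^sub>R x + v *\<^sub>R y of (x, x') \<Rightarrow> scalar_g W x x')
      \<le> u * (case x of (x, x') \<Rightarrow> scalar_g W x x') + v * (case y of (x, x') \<Rightarrow> scalar_g W x x')"
    using square_convex_comb[OF uv, of "a - b" "c - d"]
    by (simp add: scalar_g_def x y)
qed (use assms in simp)

lemma sq_diff_le:
  fixes x y W :: real
  assumes "x \<in> {-W..W}" "y \<in> {-W..W}"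
  shows "(x - y)\<^sup>2 \<le> 4 * W\<^sup>2"
proof -
  have "(x - y)\<^sup>2 \<le> (2 * W)\<^sup>2" using assms by (intro power2_le_iff_abs_le[THEN iffD2]) auto
  then show ?thesis by (simp add: power_mult_distrib)
qed

lemma scalar_g_nonpos:
  assumes "x \<in> {-W..W}" "y \<in> {-W..W}"
  shows "scalar_g W x y \<le> 0"
  using sq_diff_le[OF assms] by (simp add: scalar_g_def)

lemma GDERIV_scalar_U: "GDERIV (scalar_U w) x :> w - x"
  unfolding gderiv_def scalar_U_def
  by (auto intro!: derivative_eq_intros simp: field_simps fun_eq_iff)

lemma gradient_scalar_U: "gradient (scalar_U w) x = w - x"
  unfolding gradient_def
proof (rule the_equality)
  show "GDERIV (scalar_U w) x :> w - x" by (rule GDERIV_scalar_U)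
  fix D assume D: "GDERIV (scalar_U w) x :> D"
  have "(\<lambda>h. inner h D) = (\<lambda>h. inner h (w - x))"
    using D GDERIV_scalar_U[of w x] unfolding gderiv_def by (rule has_derivative_unique)
  from fun_cong[OF this, of 1] show "D = w - x" by simp
qed

text \<open>The gradients \<open>w t - x\<close> at consecutive times differ by a quantity free of
  \<open>x\<close>, so each supremum is that of a constant; nonemptiness of \<open>X\<close> makes
  it equal to that constant.\<close>

lemma sq_grad_variation_scalar_U:
  assumes "X \<noteq> {}"
  shows "sq_grad_variation X T (\<lambda>t. scalar_U (w t)) = (\<Sum>t=1..<T. (w (t + 1) - w t)\<^sup>2)"
  using assms by (simp add: sq_grad_variation_def gradient_scalar_U)

lemma sum_sq_steps_le:
  fixes W :: real
  assumes "\<forall>t\<in>{1..T}. v t \<in> {-W..W}"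
  shows "(\<Sum>t=1..<T. (v (t + 1) - v t)\<^sup>2) \<le> 4 * W\<^sup>2 * real T"
proof -
  have "(\<Sum>t=1..<T. (v (t + 1) - v t)\<^sup>2) \<le> (\<Sum>t=1..<T. 4 * W\<^sup>2)"
    using assms by (intro sum_mono sq_diff_le) auto
  also have "\<dots> = 4 * W\<^sup>2 * real (T - 1)" by simp
  also have "\<dots> \<le> 4 * W\<^sup>2 * real T" by (intro mult_left_mono) auto
  finally show ?thesis .
qed

section \<open>Offline optimum and regret for prescribed targets\<close>

lemma sum_split_first:
  fixes f :: "nat \<Rightarrow> 'a::comm_monoid_add"
  assumes "1 \<le> T"
  shows "(\<Sum>t=1..T. f t) = f 1 + (\<Sum>t=2..T. f t)"
  using sum.atLeast_Suc_atMost[OF assms, of f] by (simp add: numeral_2_eq_2)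

text \<open>Feasibility fixes \<open>x 1 = s\<close>, so the first summand is the same for every
  competitor. The rest is minus half a sum of squares, whose maximum 0 is attained by following
  \<open>w\<close>, and this is feasible because the coupling constraint holds throughout the
  interval. Any maximiser must make every square vanish, which gives uniqueness on
  \<open>{2..T}\<close>.\<close>

lemma offline_solution_scalar_iff:
  fixes W s :: real and w :: "nat \<Rightarrow> real"
  assumes X: "{-W..W} \<subseteq> X" and T: "1 \<le> T"
    and w: "\<forall>t\<in>{1..T}. w t \<in> {-W..W}" and s: "s \<in> {-W..W}"
  shows "offline_solution X s (\<lambda>t. scalar_U (w t)) (\<lambda>t. scalar_g W) T xs \<longleftrightarrow>
    xs 1 = s \<and> (\<forall>t\<in>{2..T}. xs t = w t)" (is "?L \<longleftrightarrow> ?R")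
proof -
  let ?V = "\<lambda>y :: nat \<Rightarrow> real. \<Sum>t=1..T. scalar_U (w t) (y t)"
  let ?F = "offline_feasible X s (\<lambda>t. scalar_g W) T"
  have V: "?V y = scalar_U (w 1) s - 1/2 * (\<Sum>t=2..T. (y t - w t)\<^sup>2)" if "y 1 = s" for y
    unfolding sum_split_first[OF T] using that by (simp add: scalar_U_def sum_distrib_left sum_negf)
  have nonneg: "0 \<le> (\<Sum>t=2..T. (y t - w t)\<^sup>2)" for y :: "nat \<Rightarrow> real"
    by (intro sum_nonneg) auto
  have F: "?F y" if y: "y 1 = s" "\<forall>t\<in>{2..T}. y t = w t" for y
  proof -
    have "y t \<in> {-W..W}" if "t \<in> {1..T}" for t
      using y w s that by (cases "t = 1") auto
    then have "(\<forall>t\<in>{1..T}. y t \<in> {-W..W}) \<and> (\<forall>t\<in>{1..<T}. scalar_g W (y t) (y (t + 1)) \<le> 0)"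
      by (intro conjI ballI scalar_g_nonpos) auto
    then show ?thesis using X y(1) by (auto simp: offline_feasible_def)
  qed
  have V0: "?V y = scalar_U (w 1) s" if y: "y 1 = s" "\<forall>t\<in>{2..T}. y t = w t" for y
    using y V[of y] by simp
  show ?thesis
  proof
    assume ?L
    then have xs1: "xs 1 = s" and opt: "\<And>y. ?F y \<Longrightarrow> ?V y \<le> ?V xs"
      by (auto simp: offline_solution_def is_arg_max_def offline_feasible_def not_less)
    define z where "z = (\<lambda>t. if t = 1 then s else w t)"
    have z: "z 1 = s" "\<forall>t\<in>{2..T}. z t = w t" by (auto simp: z_def)
    from opt[OF F[of z, OF z]] have "(\<Sum>t=2..T. (xs t - w t)\<^sup>2) \<le> 0"
      using V0[of z, OF z] V[of xs, OF xs1] by simp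
    with nonneg[of xs] have "(\<Sum>t=2..T. (xs t - w t)\<^sup>2) = 0" by simp
    then show ?R using xs1 by (simp add: sum_nonneg_eq_0_iff)
  next
    assume R: ?R
    have "?V y \<le> ?V xs" if "?F y" for y
      using V[of y] nonneg[of y] V0[of xs] R that by (simp add: offline_feasible_def)
    then show ?L using F[of xs] R
      by (auto simp: offline_solution_def is_arg_max_def not_less)
  qed
qed

lemma offline_solution_scalar_iff_aligned:
  fixes W :: real and w :: "nat \<Rightarrow> real"
  assumes X: "{-W..W} \<subseteq> X" and T: "1 \<le> T" and w: "\<forall>t\<in>{1..T}. w t \<in> {-W..W}"
  shows "offline_solution X (w 1) (\<lambda>t. scalar_U (w t)) (\<lambda>t. scalar_g W) T xs \<longleftrightarrow>
    (\<forall>t\<in>{1..T}. xs t = w t)"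
proof -
  have "{1..T} = insert 1 {2..T}" using T by auto
  moreover have "w 1 \<in> {-W..W}" using w T by auto
  ultimately show ?thesis
    using offline_solution_scalar_iff[OF X T w, of "w 1" xs] by simp
qed

text \<open>The comparator is tied to \<open>s\<close> at time 1 and so may miss \<open>w 1\<close>;
  the subtracted term is its own loss there.\<close>

lemma regret_scalar:
  fixes w :: "nat \<Rightarrow> real"
  assumes T: "1 \<le> T" and xs: "xs 1 = s" "\<forall>t\<in>{2..T}. xs t = w t"
  shows "regret T (\<lambda>t. scalar_U (w t)) xs x =
    1/2 * (\<Sum>t=1..T. (x t - w t)\<^sup>2) - 1/2 * (s - w 1)\<^sup>2"
proof -
  have "(\<Sum>t=1..T. scalar_U (w t) (xs t)) = - (1/2) * (s - w 1)\<^sup>2"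
    unfolding sum_split_first[OF T] using xs by (simp add: scalar_U_def)
  moreover have "(\<Sum>t=1..T. scalar_U (w t) (x t)) = - (1/2 * (\<Sum>t=1..T. (x t - w t)\<^sup>2))"
    by (simp add: scalar_U_def sum_distrib_left sum_negf)
  ultimately show ?thesis by (simp add: regret_def)
qed

lemma regret_scalar_aligned:
  fixes w :: "nat \<Rightarrow> real"
  assumes T: "1 \<le> T" and xs: "\<forall>t\<in>{1..T}. xs t = w t"
  shows "regret T (\<lambda>t. scalar_U (w t)) xs x = 1/2 * (\<Sum>t=1..T. (x t - w t)\<^sup>2)"
  using regret_scalar[OF T, of xs "w 1" w x] T xs by simp

text \<open>The policy's error at time 1 equals that of the comparator, so the two cancel.\<close>

lemma regret_scalar_common_start:
  fixes w :: "nat \<Rightarrow> real"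
  assumes T: "1 \<le> T" and xs: "xs 1 = s" "\<forall>t\<in>{2..T}. xs t = w t" and x: "x 1 = s"
  shows "regret T (\<lambda>t. scalar_U (w t)) xs x = 1/2 * (\<Sum>t=2..T. (x t - w t)\<^sup>2)"
  unfolding regret_scalar[OF T xs] sum_split_first[OF T] using x by (simp add: field_simps)

section \<open>Targets on the side opposite to the action\<close>

lemma sign_target_error:
  "(x - - W * sign1 x)\<^sup>2 = x\<^sup>2 + W\<^sup>2 + 2 * W * \<bar>x\<bar>"
proof -
  consider "x = 0" | "x > 0" | "x < 0" by linarith
  then show ?thesis
    by cases (auto simp: sign1_def power2_eq_square algebra_simps)
qed

text \<open>The convention \<open>sign1 0 = 1\<close> matters at the action 0, where
  \<open>sgn\<close> would give error 0.\<close>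

lemma sign_target_error_ge:
  assumes "0 \<le> W"
  shows "W\<^sup>2 \<le> (x - - W * sign1 x)\<^sup>2"
  using assms unfolding sign_target_error by simp

lemma sign_target_in_range:
  assumes "0 \<le> W"
  shows "- W * sign1 x \<in> {-W..W}"
  using assms by (auto simp: sign1_def sgn_if)

lemma sign_targets_sum:
  fixes W :: real
  assumes W: "0 \<le> W" and A: "\<forall>t\<in>A. w t = - W * sign1 (x t)"
  shows "(\<Sum>t\<in>A. (x t - w t)\<^sup>2) = (\<Sum>t\<in>A. (x t)\<^sup>2 + W\<^sup>2 + 2 * W * \<bar>x t\<bar>)"
    and "W\<^sup>2 * real (card A) \<le> (\<Sum>t\<in>A. (x t - w t)\<^sup>2)"
proof -
  show eq: "(\<Sum>t\<in>A. (x t - w t)\<^sup>2) = (\<Sum>t\<in>A. (x t)\<^sup>2 + W\<^sup>2 + 2 * W * \<bar>x t\<bar>)"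
    using A sign_target_error by (intro sum.cong) auto
  have "(\<Sum>t\<in>A. W\<^sup>2) \<le> (\<Sum>t\<in>A. (x t - w t)\<^sup>2)"
    using A sign_target_error_ge[OF W] by (intro sum_mono) auto
  then show "W\<^sup>2 * real (card A) \<le> (\<Sum>t\<in>A. (x t - w t)\<^sup>2)"
    by (simp add: mult.commute)
qed

section \<open>The sequential game against the sign adversary\<close>

lemma length_play:
  "length (fst (play p A t)) = t" "length (snd (play p A t)) = t"
  by (induction t) (auto simp: Let_def split: prod.splits)

text \<open>At \<open>t = 0\<close> the lists are empty and \<open>last\<close> is unspecified,
  hence the assumption on \<open>t\<close>.\<close>

lemma revealed_eq:
  assumes "1 \<le> t"
  shows "revealed_U p A t = fst (A (fst (play p A t)))"
    and "revealed_g p A t = snd (A (fst (play p A t)))"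
proof -
  have "last (snd (play p A t)) = A (fst (play p A t))"
    using assms by (cases t) (auto simp: Let_def split: prod.splits)
  then show "revealed_U p A t = fst (A (fst (play p A t)))"
    and "revealed_g p A t = snd (A (fst (play p A t)))"
    by (auto simp: revealed_U_def revealed_g_def)
qed

lemma offline_solution_cong:
  assumes "\<And>t. t \<in> {1..T} \<Longrightarrow> U t = U' t" "\<And>t. t \<in> {1..T} \<Longrightarrow> g t = g' t"
  shows "offline_solution X s U g T xs \<longleftrightarrow> offline_solution X s U' g' T xs"
proof -
  have "offline_feasible X s g T = offline_feasible X s g' T"
    using assms(2) by (auto simp: offline_feasible_def fun_eq_iff)
  moreover have "(\<lambda>x. \<Sum>t=1..T. U t (x t)) = (\<lambda>x. \<Sum>t=1..T. U' t (x t))"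
    using assms(1) by (auto intro!: sum.cong)
  ultimately show ?thesis by (simp add: offline_solution_def)
qed

lemma regret_cong:
  assumes "\<And>t. t \<in> {1..T} \<Longrightarrow> U t = U' t"
  shows "regret T U xs x = regret T U' xs x"
  using assms by (simp add: regret_def)

text \<open>Once the policy is fixed, the play determines all actions. The adaptive targets then
  form one particular sequence \<open>w\<close>, to which the results for prescribed targets
  apply.\<close>

lemma sign_adversary_game:
  fixes p :: "real policy" and W :: real
  defines "w \<equiv> \<lambda>t. - W * sign1 (action p (sign_adversary W) t)"
  shows "offline_solution X s (revealed_U p (sign_adversary W)) (revealed_g p (sign_adversary W)) T xs \<longleftrightarrow>
      offline_solution X s (\<lambda>t. scalar_U (w t)) (\<lambda>t. scalar_g W) T xs"
    and "regret T (revealed_U p (sign_adversary W)) xs x = regret T (\<lambda>t. scalar_U (w t)) xs x"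
  by (intro offline_solution_cong regret_cong;
      simp add: revealed_eq sign_adversary_def w_def action_def)+

text \<open>The comparator's own loss at time 1 is at most \<open>2 * W\<^sup>2\<close>, which is 4
  units of \<open>W\<^sup>2 / 2\<close>; hence \<open>real T - 4\<close>. The upper bound discards
  this loss and uses that two points of the interval are at most \<open>2 * W\<close> apart.\<close>

lemma sign_adversary_regret:
  fixes p :: "real policy" and W :: real
  defines "A \<equiv> sign_adversary W"
  assumes W: "0 \<le> W" and X: "{-W..W} \<subseteq> X" and s: "s \<in> {-W..W}" and T: "1 \<le> T"
    and sol: "offline_solution X s (revealed_U p A) (revealed_g p A) T xs"
  shows "W\<^sup>2 / 2 * (real T - 4) \<le> regret T (revealed_U p A) xs (action p A)"
    and "(\<forall>t\<in>{1..T}. action p A t \<in> {-W..W}) \<Longrightarrow>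
      regret T (revealed_U p A) xs (action p A) \<le> 2 * W\<^sup>2 * real T"
proof -
  define w where "w = (\<lambda>t. - W * sign1 (action p A t))"
  have w: "\<forall>t\<in>{1..T}. w t \<in> {-W..W}"
    unfolding w_def using sign_target_in_range[OF W] by blast
  have "xs 1 = s \<and> (\<forall>t\<in>{2..T}. xs t = w t)"
    using sol offline_solution_scalar_iff[OF X T w s]
    unfolding A_def w_def sign_adversary_game(1) by blast
  then have reg: "regret T (revealed_U p A) xs (action p A) =
      1/2 * (\<Sum>t=1..T. (action p A t - w t)\<^sup>2) - 1/2 * (s - w 1)\<^sup>2"
    using regret_scalar[OF T, of xs s w "action p A"] sign_adversary_game(2)
    unfolding A_def w_def by simp
  have "(s - w 1)\<^sup>2 \<le> 4 * W\<^sup>2"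
    using s w T by (intro sq_diff_le) auto
  moreover have "W\<^sup>2 * real T \<le> (\<Sum>t=1..T. (action p A t - w t)\<^sup>2)"
    using sign_targets_sum(2)[OF W, of "{1..T}" w "action p A"] by (simp add: w_def)
  moreover have "W\<^sup>2 / 2 * (real T - 4) = 1/2 * (W\<^sup>2 * real T) - 1/2 * (4 * W\<^sup>2)"
    by (simp add: field_simps)
  ultimately show "W\<^sup>2 / 2 * (real T - 4) \<le> regret T (revealed_U p A) xs (action p A)"
    unfolding reg by linarith
  show "regret T (revealed_U p A) xs (action p A) \<le> 2 * W\<^sup>2 * real T"
    if "\<forall>t\<in>{1..T}. action p A t \<in> {-W..W}"
  proof -
    have "(\<Sum>t=1..T. (action p A t - w t)\<^sup>2) \<le> (\<Sum>t=1..T. 4 * W\<^sup>2)"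
      using that w by (intro sum_mono sq_diff_le) auto
    then have "(\<Sum>t=1..T. (action p A t - w t)\<^sup>2) \<le> 4 * W\<^sup>2 * real T" by (simp add: mult.commute)
    then show ?thesis unfolding reg using zero_le_power2[of "s - w 1"] by linarith
  qed
qed

section \<open>An adversary forcing linear path length and linear regret\<close>

definition alternating_target :: "real list \<Rightarrow> real" where
  "alternating_target h = (if even (length h) then - sign1 (last h) else 0)"

definition alternating_adversary :: "real adversary" where
  "alternating_adversary h = (scalar_U (alternating_target h), scalar_g 1)"

text \<open>The history contains the current action, so its length is the current time. The target 0
  at odd times makes \<open>w 1\<close> agree with the prescribed start, so the offline optimum
  meets every target. Each even time costs the policy at least 1/2, whatever it plays.\<close>

lemma alternating_adversary_game:
  fixes p :: "real policy"
  defines "A \<equiv> alternating_adversary"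
  defines "w \<equiv> \<lambda>t. if even t then - sign1 (action p A t) else 0"
  shows "offline_solution UNIV 0 (revealed_U p A) (revealed_g p A) T xs \<longleftrightarrow>
      xs 1 = 0 \<and> (\<forall>t\<in>{1..T}. xs t = w t)"
    and "1 \<le> T \<Longrightarrow> offline_solution UNIV 0 (revealed_U p A) (revealed_g p A) T xs \<Longrightarrow>
      sq_path_length T xs = real T - 1"
    and "1 \<le> T \<Longrightarrow> offline_solution UNIV 0 (revealed_U p A) (revealed_g p A) T xs \<Longrightarrow>
      (real T - 1) / 4 \<le> regret T (revealed_U p A) xs (action p A)"
proof -
  have U: "revealed_U p A t = scalar_U (w t)" and g: "revealed_g p A t = scalar_g 1"
    if "t \<in> {1..T}" for t
    using that by (simp_all add: revealed_eq A_def alternating_adversary_def alternating_target_def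
        w_def action_def length_play)
  have w: "\<forall>t\<in>{1..T}. w t \<in> {-1..1}" for T
    using sign_target_in_range[of 1] by (auto simp: w_def)
  have w1: "w 1 = 0" by (simp add: w_def)
  show iff: "offline_solution UNIV 0 (revealed_U p A) (revealed_g p A) T xs \<longleftrightarrow>
      xs 1 = 0 \<and> (\<forall>t\<in>{1..T}. xs t = w t)"
  proof (cases "1 \<le> T")
    case True
    have "offline_solution UNIV 0 (revealed_U p A) (revealed_g p A) T xs \<longleftrightarrow>
        offline_solution UNIV (w 1) (\<lambda>t. scalar_U (w t)) (\<lambda>t. scalar_g 1) T xs"
      unfolding w1 using U g by (intro offline_solution_cong)
    also have "\<dots> \<longleftrightarrow> (\<forall>t\<in>{1..T}. xs t = w t)"
      by (rule offline_solution_scalar_iff_aligned[OF _ True w]) simp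
    finally show ?thesis using True w1 by auto
  next
    case False
    \<comment> \<open>For the empty horizon all sums vanish, and \<open>xs 1 = 0\<close> is the only
      condition left.\<close>
    then have "T = 0" by simp
    then show ?thesis
      by (simp add: offline_solution_def is_arg_max_def offline_feasible_def)
  qed
  show "sq_path_length T xs = real T - 1"
    if T: "1 \<le> T" and sol: "offline_solution UNIV 0 (revealed_U p A) (revealed_g p A) T xs"
  proof -
    \<comment> \<open>Of two consecutive targets one is 0 and the other is 1 or -1.\<close>
    have step: "(w (t + 1) - w t)\<^sup>2 = 1" for t
      by (cases "even t") (auto simp: w_def sign1_def sgn_if)
    have "sq_path_length T xs = (\<Sum>t=1..<T. (w (t + 1) - w t)\<^sup>2)"
      using sol iff by (auto simp: sq_path_length_def intro!: sum.cong)
    then show ?thesis unfolding step using T by (simp add: of_nat_diff)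
  qed
  show "(real T - 1) / 4 \<le> regret T (revealed_U p A) xs (action p A)"
    if T: "1 \<le> T" and sol: "offline_solution UNIV 0 (revealed_U p A) (revealed_g p A) T xs"
  proof -
    let ?x = "action p A"
    have err: "(if even t then 1 else 0) \<le> (?x t - w t)\<^sup>2" for t
      using sign_target_error_ge[of 1 "?x t"] by (simp add: w_def)
    \<comment> \<open>Two further stages contribute exactly one even time, so the induction goes
      from \<open>m\<close> to \<open>m + 2\<close> with two base cases.\<close>
    have count: "(real T - 1) / 2 \<le> (\<Sum>t=1..T. if even t then 1 else 0 :: real)" for T :: nat
    proof (induction T rule: less_induct)
      case (less n)
      consider "n = 0" | "n = 1" | m where "n = Suc (Suc m)" by (metis One_nat_def not0_implies_Suc)
      then show ?case
        by cases (use less.IH in \<open>auto simp: field_simps\<close>)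
    qed
    have "(real T - 1) / 2 \<le> (\<Sum>t=1..T. (?x t - w t)\<^sup>2)"
      using count[of T] sum_mono[of "{1..T}", OF err] by (rule order_trans)
    moreover have "regret T (revealed_U p A) xs ?x = regret T (\<lambda>t. scalar_U (w t)) xs ?x"
      using U by (rule regret_cong)
    moreover have "\<dots> = 1/2 * (\<Sum>t=1..T. (?x t - w t)\<^sup>2)"
      using T sol iff by (intro regret_scalar_aligned) auto
    ultimately show ?thesis by simp
  qed
qed

section \<open>Online gradient ascent on the scalar construction\<close>

lemma oga_step_condition_bounds:
  assumes step: "\<forall>T\<ge>1. oga_step_condition a 1 T" and t: "1 \<le> t"
  shows "1 < a t" "a t \<le> 2 * a 1 - 1"
proof -
  have ne: "finite (a ` {1..t})" "a ` {1..t} \<noteq> {}" using t by auto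
  \<comment> \<open>As the minimum is at most the maximum, this forces the minimum above 1; as it is
    also at most \<open>a 1\<close>, the maximum stays below a bound that does not depend on
    \<open>t\<close>.\<close>
  have "Max (a ` {1..t}) < 2 * Min (a ` {1..t}) - 1"
    using step t by (auto simp: oga_step_condition_def)
  moreover have "a t \<le> Max (a ` {1..t})" "Min (a ` {1..t}) \<le> a t" "Min (a ` {1..t}) \<le> a 1"
    using ne t by (auto intro!: Max_ge Min_le)
  ultimately show "1 < a t" "a t \<le> 2 * a 1 - 1" by auto
qed

lemma oga_iterates_in_set:
  assumes "oga_iterates X s a U T x" "closed X" "X \<noteq> {}" "s \<in> X" "t \<in> {1..T}"
  shows "x t \<in> X"
proof (cases "t = 1")
  case False
  then have "t - 1 \<in> {1..<T}" "t = t - 1 + 1" using assms(5) by auto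
  then have "x t = closest_point X (x (t - 1) + (1 / a (t - 1)) *\<^sub>R gradient (U (t - 1)) (x (t - 1)))"
    using assms(1) unfolding oga_iterates_def by metis
  then show ?thesis using assms(2,3) closest_point_in_set by metis
qed (use assms in \<open>simp add: oga_iterates_def\<close>)

text \<open>As \<open>1 / a(t) < 1\<close>, the step lands between \<open>x(t)\<close> and \<open>w(t)\<close> and the projection is idle.\<close>

lemma oga_scalar_step:
  fixes x w :: "nat \<Rightarrow> real"
  assumes it: "oga_iterates {-W..W} s a (\<lambda>t. scalar_U (w t)) T x"
    and t: "t \<in> {1..<T}" and s: "s \<in> {-W..W}" and w: "\<forall>t\<in>{1..T}. w t \<in> {-W..W}"
    and a: "1 < a t"
  shows "x (t + 1) - w t = (1 - 1 / a t) * (x t - w t)"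
proof -
  have xt: "x t \<in> {-W..W}"
    using s t by (intro oga_iterates_in_set[OF it]) auto
  have "(1 - 1 / a t) *\<^sub>R x t + (1 / a t) *\<^sub>R w t \<in> {-W..W}"
    using xt w t a by (intro convexD[OF convex_real_interval(5)]) auto
  then have "x t + (1 / a t) *\<^sub>R (w t - x t) \<in> {-W..W}"
    by (simp add: algebra_simps)
  then have "x (t + 1) = x t + (1 / a t) *\<^sub>R (w t - x t)"
    using it t by (simp add: oga_iterates_def gradient_scalar_U closest_point_self)
  then show ?thesis by (simp add: algebra_simps)
qed

text \<open>Summing the recursion puts \<open>?E\<close> on both sides, with factor
  \<open>1 - c\<close> on the right. Absorbing it leaves \<open>c * ?E\<close>; the second power of
  \<open>c\<close> comes from the terms \<open>d t / c\<close>.\<close>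

lemma sum_contraction_bound:
  fixes e d :: "nat \<Rightarrow> real"
  assumes c: "0 < c" "c \<le> 1" and d: "\<And>t. 0 \<le> d t" and e: "\<And>t. 0 \<le> e t" and T: "1 \<le> T"
    and rec: "\<And>t. t \<in> {1..<T} \<Longrightarrow> e (t + 1) \<le> (1 - c) * e t + d t / c"
  shows "(\<Sum>t=2..T. e t) \<le> (e 1 + (\<Sum>t=1..<T. d t)) / c\<^sup>2"
proof -
  let ?E = "\<Sum>t=2..T. e t" and ?D = "\<Sum>t=1..<T. d t"
  have shift: "?E = (\<Sum>t=1..<T. e (t + 1))"
  proof -
    have "{2..T} = {Suc 1..<Suc T}" by auto
    then show ?thesis by (simp add: sum.shift_bounds_Suc_ivl del: sum.op_ivl_Suc)
  qed
  have "(\<Sum>t=1..<T. e t) \<le> (\<Sum>t=1..T. e t)"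
    using e by (intro sum_mono2) auto
  also have "\<dots> = e 1 + ?E" by (rule sum_split_first[OF T])
  finally have prev: "(\<Sum>t=1..<T. e t) \<le> e 1 + ?E" .
  have "?E \<le> (\<Sum>t=1..<T. (1 - c) * e t + d t / c)"
    unfolding shift by (rule sum_mono) (rule rec)
  also have "\<dots> = (1 - c) * (\<Sum>t=1..<T. e t) + ?D / c"
    by (simp add: sum.distrib sum_distrib_left sum_divide_distrib)
  also have "\<dots> \<le> (1 - c) * (e 1 + ?E) + ?D / c"
    using prev c by (intro add_right_mono mult_left_mono) auto
  finally have "c * ?E \<le> (1 - c) * e 1 + ?D / c" by (simp add: algebra_simps)
  also have "(1 - c) * e 1 \<le> e 1 / c"
  proof -
    have "(1 - c) * e 1 \<le> 1 * e 1" using c e[of 1] by (intro mult_right_mono) auto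
    also have "\<dots> \<le> e 1 / c" using c mult_right_mono[of c 1 "e 1"] e[of 1] by (simp add: field_simps)
    finally show ?thesis .
  qed
  finally have "c * ?E \<le> (e 1 + ?D) / c" by (simp add: add_divide_distrib)
  then show ?thesis using c by (simp add: field_simps power2_eq_square)
qed

text \<open>Squared tracking errors satisfy a contraction recursion driven by the squared target
  steps, so it remains to bound the initial error \<open>s - w 1\<close>. For \<open>T\<close> at
  least 2 it is routed through \<open>w 2\<close>: from \<open>s\<close> to \<open>w 2\<close> is
  the first offline step, and from \<open>w 2\<close> to \<open>w 1\<close> is counted in the
  gradient variation.\<close>

lemma oga_scalar_regret:
  fixes x xs w :: "nat \<Rightarrow> real" and T :: nat
  defines "M \<equiv> sq_path_length T xs + (\<Sum>t=1..<T. (w (t + 1) - w t)\<^sup>2)"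
  assumes it: "oga_iterates {-W..W} s a (\<lambda>t. scalar_U (w t)) T x"
    and s: "s \<in> {-W..W}" and w: "\<forall>t\<in>{1..T}. w t \<in> {-W..W}"
    and a: "\<And>t. 1 \<le> t \<Longrightarrow> 1 < a t" "\<And>t. 1 \<le> t \<Longrightarrow> a t \<le> b"
    and T: "1 \<le> T" and xs: "xs 1 = s" "\<forall>t\<in>{2..T}. xs t = w t"
  shows "0 \<le> regret T (\<lambda>t. scalar_U (w t)) xs x"
    and "regret T (\<lambda>t. scalar_U (w t)) xs x \<le> 3 * b\<^sup>2 * M"
proof -
  let ?G = "\<Sum>t=1..<T. (w (t + 1) - w t)\<^sup>2"
  have x1: "x 1 = s" using it by (simp add: oga_iterates_def)
  have reg: "regret T (\<lambda>t. scalar_U (w t)) xs x = 1/2 * (\<Sum>t=2..T. (x t - w t)\<^sup>2)"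
    using T xs x1 by (rule regret_scalar_common_start)
  show "0 \<le> regret T (\<lambda>t. scalar_U (w t)) xs x"
    unfolding reg by (simp add: sum_nonneg)
  have b: "1 < b" using a[of 1] by simp
  have G: "0 \<le> ?G" and S: "0 \<le> sq_path_length T xs"
    by (auto simp: sq_path_length_def intro: sum_nonneg)
  show "regret T (\<lambda>t. scalar_U (w t)) xs x \<le> 3 * b\<^sup>2 * M"
  proof (cases "T = 1")
    \<comment> \<open>With a single stage there is no \<open>w 2\<close> to route through, but the
      regret is then an empty sum.\<close>
    case True
    then have "regret T (\<lambda>t. scalar_U (w t)) xs x = 0" unfolding reg by simp
    then show ?thesis using G S by (simp add: M_def)
  next
    case False
    then have T2: "1 \<in> {1..<T}" using T by simp
    have "(x (t + 1) - w (t + 1))\<^sup>2 \<le> (1 - 1/b) * (x t - w t)\<^sup>2 + (w (t + 1) - w t)\<^sup>2 / (1/b)"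
      if t: "t \<in> {1..<T}" for t
    proof -
      have at: "1 < a t" "a t \<le> b" using a[of t] t by auto
      define r where "r = (1 - 1 / a t) * (x t - w t)"
      have "\<bar>r\<bar> = (1 - 1 / a t) * \<bar>x t - w t\<bar>"
        unfolding r_def abs_mult using at by simp
      also have "\<dots> \<le> (1 - 1/b) * \<bar>x t - w t\<bar>"
        using at by (intro mult_right_mono) (auto simp: frac_le)
      finally have r: "\<bar>r\<bar> \<le> (1 - 1/b) * \<bar>x t - w t\<bar>" .
      have "x (t + 1) - w (t + 1) = r - (w (t + 1) - w t)"
        using oga_scalar_step[OF it t s w at(1)] by (simp add: r_def)
      \<comment> \<open>Writing the target step as \<open>1/b\<close> times its
        \<open>b\<close>-fold makes the right side a convex combination, so that squaring keeps the
        factor \<open>1 - 1/b\<close> on the old error.\<close>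
      then have "\<bar>x (t + 1) - w (t + 1)\<bar> \<le> (1 - 1/b) * \<bar>x t - w t\<bar> + (1/b) * (b * \<bar>w (t + 1) - w t\<bar>)"
        using r b by simp
      then have "(x (t + 1) - w (t + 1))\<^sup>2
          \<le> ((1 - 1/b) * \<bar>x t - w t\<bar> + (1/b) * (b * \<bar>w (t + 1) - w t\<bar>))\<^sup>2"
        using abs_le_square_iff by fastforce
      also have "\<dots> \<le> (1 - 1/b) * \<bar>x t - w t\<bar>\<^sup>2 + (1/b) * (b * \<bar>w (t + 1) - w t\<bar>)\<^sup>2"
        using b by (intro square_convex_comb) auto
      also have "\<dots> = (1 - 1/b) * (x t - w t)\<^sup>2 + (w (t + 1) - w t)\<^sup>2 / (1/b)"
        using b by (simp add: power_mult_distrib power2_eq_square)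
      finally show ?thesis .
    qed
    then have "(\<Sum>t=2..T. (x t - w t)\<^sup>2) \<le> ((x 1 - w 1)\<^sup>2 + ?G) / (1/b)\<^sup>2"
      using b T by (intro sum_contraction_bound) auto
    also have "\<dots> = b\<^sup>2 * ((x 1 - w 1)\<^sup>2 + ?G)" by (simp add: power_divide)
    also have "\<dots> \<le> b\<^sup>2 * (3 * M)"
    proof (rule mult_left_mono)
      have "(w 2 - s)\<^sup>2 \<le> sq_path_length T xs"
        using member_le_sum[OF T2, of "\<lambda>t. (norm (xs (t + 1) - xs t))\<^sup>2"] xs T2
        by (simp add: sq_path_length_def numeral_2_eq_2)
      moreover have "(w 2 - w 1)\<^sup>2 \<le> ?G"
        using member_le_sum[OF T2, of "\<lambda>t. (w (t + 1) - w t)\<^sup>2"] by (simp add: numeral_2_eq_2)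
      moreover have "(x 1 - w 1)\<^sup>2 \<le> 2 * (w 2 - s)\<^sup>2 + 2 * (w 2 - w 1)\<^sup>2"
        using square_convex_comb[of "1/2" "1/2" "s - w 2" "w 2 - w 1"] unfolding x1
        by (simp add: power2_eq_square algebra_simps)
      ultimately show "(x 1 - w 1)\<^sup>2 + ?G \<le> 3 * M"
        unfolding M_def using S by simp
    qed simp
    finally have "(\<Sum>t=2..T. (x t - w t)\<^sup>2) \<le> b\<^sup>2 * (3 * M)" .
    moreover have "0 \<le> b\<^sup>2 * M" using G S by (simp add: M_def)
    ultimately show ?thesis unfolding reg by linarith
  qed
qed

text \<open>Adding half the squared norm cancels the quadratic term and leaves an affine function,
  so \<open>m = 1\<close>. The gradient \<open>w t - x\<close> is an isometry in \<open>x\<close>,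
  so \<open>L = 1\<close>. Its size is at most \<open>2 * W\<close>, hence at most 2. None of these
  constants depends on \<open>T\<close>.\<close>

lemma oga_regime_scalar:
  fixes x w :: "nat \<Rightarrow> real"
  assumes it: "oga_iterates {-W..W} s a (\<lambda>t. scalar_U (w t)) T x"
    and s: "s \<in> {-W..W}" and w: "\<forall>t\<in>{1..T}. w t \<in> {-W..W}" and W: "W \<le> 1"
    and step: "oga_step_condition a 1 T"
  shows "oga_regime {-W..W} (\<lambda>t. scalar_U (w t)) (\<lambda>t. scalar_g W) T 1 1 2 a x"
  unfolding oga_regime_def
proof (intro conjI ballI)
  fix t assume t: "t \<in> {1..T}"
  have "(\<lambda>x. scalar_U (w t) x + 1 / 2 * (norm x)\<^sup>2) = (\<lambda>x. w t * x - (w t)\<^sup>2 / 2)"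
    by (simp add: scalar_U_def power2_eq_square field_simps)
  moreover have "concave_on {-W..W} (\<lambda>x. w t * x - (w t)\<^sup>2 / 2)"
    unfolding concave_on_def convex_on_def
  proof (intro conjI ballI allI impI)
    fix x y u v :: real
    assume "u + v = 1"
    then have v: "v = 1 - u" by simp
    show "- (w t * (u *\<^sub>R x + v *\<^sub>R y) - (w t)\<^sup>2 / 2)
        \<le> u * - (w t * x - (w t)\<^sup>2 / 2) + v * - (w t * y - (w t)\<^sup>2 / 2)"
      unfolding v by (simp add: field_simps)
  qed simp
  ultimately show "strongly_concave_on {-W..W} 1 (scalar_U (w t))"
    by (simp add: strongly_concave_on_def)
  show "1-lipschitz_on {-W..W} (gradient (scalar_U (w t)))"
    by (rule lipschitz_onI) (auto simp: gradient_scalar_U dist_real_def)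
  fix y assume y: "y \<in> {-W..W}"
  show "GDERIV (scalar_U (w t)) y :> gradient (scalar_U (w t)) y"
    unfolding gradient_scalar_U by (rule GDERIV_scalar_U)
  have "w t \<in> {-W..W}" using w t by blast
  then show "norm (gradient (scalar_U (w t)) y) \<le> 2"
    using y W by (auto simp: gradient_scalar_U)
next
  fix t assume "t \<in> {1..<T}"
  then show "scalar_g W (x t) (x (t + 1)) \<le> 0"
    using s by (intro scalar_g_nonpos oga_iterates_in_set[OF it]) auto
qed (use step in auto)

section \<open>Passage to asymptotic rates\<close>

lemma square_powr_horizon:
  fixes \<gamma> :: real
  assumes "1 \<le> T"
  shows "(real T powr (- \<gamma>))\<^sup>2 * real T = real T powr (1 - 2 * \<gamma>)"
proof -
  have "(real T powr (- \<gamma>))\<^sup>2 = real T powr (- 2 * \<gamma>)"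
    by (simp add: power2_eq_square flip: powr_add)
  then show ?thesis using assms powr_add[of "real T" "- 2 * \<gamma>" 1] by simp
qed

text \<open>Once \<open>T\<close> is at least twice \<open>\<bar>k\<bar>\<close>, the factor
  \<open>real T - k\<close> is at least \<open>real T / 2\<close>. This absorbs the additive
  corrections in the finite-horizon lower bounds.\<close>

lemma bigomegaI_shifted:
  fixes f :: "nat \<Rightarrow> real"
  assumes c: "0 < c" and f: "\<And>T. 1 \<le> T \<Longrightarrow> c * V T * (real T - k) \<le> f T"
    and V: "\<And>T. 0 \<le> V T"
  shows "f \<in> \<Omega>(\<lambda>T. V T * real T)"
proof (rule landau_omega.bigI[of "c / 2"])
  have "eventually (\<lambda>T. real T \<ge> 2 * \<bar>k\<bar> \<and> T \<ge> 1) sequentially"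
    by (intro eventually_conj eventually_ge_at_top)
       (meson eventually_at_top_linorder of_nat_mono real_arch_simple order_trans)
  then show "eventually (\<lambda>T. norm (f T) \<ge> c / 2 * norm (V T * real T)) sequentially"
  proof eventually_elim
    case (elim T)
    have "c / 2 * norm (V T * real T) = c * V T * (real T / 2)"
      using V[of T] by simp
    also have "\<dots> \<le> c * V T * (real T - k)"
      using elim c V[of T] by (intro mult_left_mono) auto
    also have "\<dots> \<le> f T" using f elim by blast
    finally show ?case by simp
  qed
qed (use c in simp)

section \<open>The individual claims of the theorem\<close>

lemma linear_regret_unavoidable:
  "\<exists>(X :: real set) s (A :: real adversary).
        decision_set X \<and> s \<in> X \<and>
        (\<forall>h. concave_on X (fst (A h)) \<and> convex_on (X \<times> X) (\<lambda>(x, x'). snd (A h) x x')) \<and>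
        (\<forall>h. \<exists>w\<in>{-1..1}. A h = (scalar_U w, scalar_g 1)) \<and>
        (\<forall>p :: nat \<Rightarrow> real policy.
           (\<forall>T. \<exists>xs. offline_solution X s (revealed_U (p T) A) (revealed_g (p T) A) T xs) \<and>
           (\<forall>xs. (\<forall>T. offline_solution X s (revealed_U (p T) A) (revealed_g (p T) A) T (xs T)) \<longrightarrow>
              (\<lambda>T. sq_path_length T (xs T)) \<in> \<Theta>(\<lambda>T. real T) \<and>
              (\<lambda>T. regret T (revealed_U (p T) A) (xs T) (action (p T) A)) \<notin> o(\<lambda>T. real T) \<and>
              (\<lambda>T. regret T (revealed_U (p T) A) (xs T) (action (p T) A)) \<in> \<Omega>(\<lambda>T. real T)))"
proof (rule exI[of _ UNIV], rule exI[of _ 0], rule exI[of _ alternating_adversary],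
    intro conjI allI impI)
  let ?A = alternating_adversary
  show "decision_set (UNIV :: real set)" by (simp add: decision_set_def)
  show "concave_on UNIV (fst (?A h))" for h
    by (simp add: alternating_adversary_def concave_on_scalar_U)
  show "convex_on (UNIV \<times> UNIV) (\<lambda>(x, x'). snd (?A h) x x')" for h
    by (simp add: alternating_adversary_def convex_on_scalar_g)
  show "\<exists>w\<in>{-1..1}. ?A h = (scalar_U w, scalar_g 1)" for h
    using sign_target_in_range[of 1 "last h"]
    by (auto simp: alternating_adversary_def alternating_target_def)
  fix p :: "nat \<Rightarrow> real policy"
  show "\<exists>xs. offline_solution UNIV 0 (revealed_U (p T) ?A) (revealed_g (p T) ?A) T xs" for T
    unfolding alternating_adversary_game(1)
    by (rule exI[of _ "\<lambda>t. if even t then - sign1 (action (p T) ?A t) else 0"]) simp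
  fix xs
  assume sol: "\<forall>T. offline_solution UNIV 0 (revealed_U (p T) ?A) (revealed_g (p T) ?A) T (xs T)"
  have "eventually (\<lambda>T. sq_path_length T (xs T) = real T - 1) sequentially"
    using eventually_ge_at_top[of 1] by eventually_elim (use sol alternating_adversary_game(2) in blast)
  moreover have "(\<lambda>T :: nat. real T - 1) \<in> \<Theta>(\<lambda>T. real T)" by real_asymp
  ultimately show "(\<lambda>T. sq_path_length T (xs T)) \<in> \<Theta>(\<lambda>T. real T)"
    by (simp add: landau_theta.in_cong)
  let ?R = "\<lambda>T. regret T (revealed_U (p T) ?A) (xs T) (action (p T) ?A)"
  have lower: "1/4 * 1 * (real T - 1) \<le> ?R T" if "1 \<le> T" for T
    using alternating_adversary_game(3)[OF that, of "p T" "xs T"] sol by simp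
  show omega: "?R \<in> \<Omega>(\<lambda>T. real T)"
    using bigomegaI_shifted[of "1/4" "\<lambda>_. 1" 1 ?R] lower by simp
  show "?R \<notin> o(\<lambda>T. real T)"
  proof
    assume "?R \<in> o(\<lambda>T. real T)"
    \<comment> \<open>A function that is both \<open>o\<close> and \<open>\<Omega>\<close> of the
      same function vanishes eventually, whereas the lower bound is positive from
      \<open>T = 2\<close> on.\<close>
    then have "eventually (\<lambda>T. ?R T = 0) sequentially"
      using omega landau_o.small_big_asymmetric by (auto simp: bigomega_iff_bigo)
    then have "eventually (\<lambda>T::nat. False) sequentially"
      using eventually_ge_at_top[of 2]
    proof eventually_elim
      case (elim T)
      then show ?case using lower[of T] by simp
    qed
    then show False by simp
  qed
qed simp

lemma scalar_construction:
  fixes W :: real and w :: "nat \<Rightarrow> real"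
  assumes W: "W \<ge> 0" and dX: "decision_set X" and X: "{-W..W} \<subseteq> X" and T: "1 \<le> T"
    and w: "\<forall>t\<in>{1..T}. w t \<in> {-W..W}"
  shows "let U = (\<lambda>t. scalar_U (w t)); g = (\<lambda>t :: nat. scalar_g W) in
          (\<forall>t. concave_on UNIV (U t) \<and> convex_on UNIV (\<lambda>(x, x'). g t x x'))
        \<and> (\<forall>x. (\<forall>t\<in>{1..T}. x t \<in> {-W..W}) \<longrightarrow> (\<forall>t\<in>{1..<T}. g t (x t) (x (t + 1)) \<le> 0))
        \<and> (\<forall>xs. offline_solution X (w 1) U g T xs \<longleftrightarrow> (\<forall>t\<in>{1..T}. xs t = w t))
        \<and> (\<forall>xs. offline_solution X (w 1) U g T xs \<longrightarrow>
              sq_path_length T xs = sq_grad_variation X T U \<and>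
              sq_grad_variation X T U = (\<Sum>t=1..<T. (w (t + 1) - w t)\<^sup>2) \<and>
              (\<Sum>t=1..<T. (w (t + 1) - w t)\<^sup>2) \<le> 4 * W\<^sup>2 * real T)
        \<and> (\<forall>xs x. offline_solution X (w 1) U g T xs \<longrightarrow>
              regret T U xs x = 1 / 2 * (\<Sum>t=1..T. (x t - w t)\<^sup>2))
        \<and> (\<forall>xs x. offline_solution X (w 1) U g T xs \<longrightarrow> (\<forall>t\<in>{1..T}. w t = - W * sign1 (x t)) \<longrightarrow>
              regret T U xs x = 1 / 2 * (\<Sum>t=1..T. (x t)\<^sup>2 + W\<^sup>2 + 2 * W * \<bar>x t\<bar>) \<and>
              regret T U xs x \<ge> W\<^sup>2 / 2 * real T)
        \<and> (\<forall>s\<in>{-W..W}.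
              (\<forall>xs. offline_solution X s U g T xs \<longleftrightarrow> xs 1 = s \<and> (\<forall>t\<in>{2..T}. xs t = w t)) \<and>
              (\<forall>xs x. offline_solution X s U g T xs \<longrightarrow> x 1 = s \<longrightarrow>
                 regret T U xs x = 1 / 2 * (\<Sum>t=2..T. (x t - w t)\<^sup>2) \<and>
                 ((\<forall>t\<in>{1..T}. w t = - W * sign1 (x t)) \<longrightarrow>
                    regret T U xs x = 1 / 2 * (\<Sum>t=2..T. (x t)\<^sup>2 + W\<^sup>2 + 2 * W * \<bar>x t\<bar>) \<and>
                    regret T U xs x \<ge> W\<^sup>2 / 2 * real (T - 1))))"
proof -
  let ?U = "\<lambda>t. scalar_U (w t)" and ?g = "\<lambda>t :: nat. scalar_g W"
  note iff1 = offline_solution_scalar_iff_aligned[OF X T w]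
  note iff = offline_solution_scalar_iff[OF X T w]
  have path: "sq_path_length T xs = (\<Sum>t=1..<T. (w (t + 1) - w t)\<^sup>2)"
    if "\<forall>t\<in>{1..T}. xs t = w t" for xs
    using that by (auto simp: sq_path_length_def intro!: sum.cong)
  have "X \<noteq> {}" using dX by (simp add: decision_set_def)
  note var = sq_grad_variation_scalar_U[OF this, of T w]
  have full: "regret T ?U xs x = 1 / 2 * (\<Sum>t=1..T. (x t)\<^sup>2 + W\<^sup>2 + 2 * W * \<bar>x t\<bar>) \<and>
      regret T ?U xs x \<ge> W\<^sup>2 / 2 * real T"
    if "\<forall>t\<in>{1..T}. xs t = w t" "\<forall>t\<in>{1..T}. w t = - W * sign1 (x t)" for xs x
    using sign_targets_sum[OF W that(2)] regret_scalar_aligned[OF T that(1), of x] by simp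
  have tail: "regret T ?U xs x = 1 / 2 * (\<Sum>t=2..T. (x t)\<^sup>2 + W\<^sup>2 + 2 * W * \<bar>x t\<bar>) \<and>
      regret T ?U xs x \<ge> W\<^sup>2 / 2 * real (T - 1)"
    if xs: "xs 1 = s" "\<forall>t\<in>{2..T}. xs t = w t" "x 1 = s" and ws: "\<forall>t\<in>{1..T}. w t = - W * sign1 (x t)"
    for xs x s
  proof -
    have "\<forall>t\<in>{2..T}. w t = - W * sign1 (x t)" using ws by auto
    from sign_targets_sum[OF W this] show ?thesis
      using regret_scalar_common_start[OF T, of xs s w x, OF xs] by simp
  qed
  show ?thesis
    unfolding Let_def
  \<comment> \<open>Case 3 is claim (i), cases 9 and 10 are claim (iv), and cases 11 to 14 concern a
    prescribed start \<open>s\<close>; the closing method handles the others.\<close>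
  proof (intro conjI allI ballI impI, goal_cases)
    case (3 x t)
    then show ?case by (intro scalar_g_nonpos) auto
  next
    case (9 xs x)
    then show ?case using iff1[of xs] full[of xs x] by blast
  next
    case (10 xs x)
    then show ?case using iff1[of xs] full[of xs x] by blast
  next
    case (11 s xs)
    then show ?case using iff by blast
  next
    case (12 s xs x)
    then show ?case using iff[of s xs] regret_scalar_common_start[OF T, of xs s w x] by blast
  next
    case (13 s xs x)
    then show ?case using iff[of s xs] tail[of xs s x] by blast
  next
    case (14 s xs x)
    then show ?case using iff[of s xs] tail[of xs s x] by blast
  qed (use iff1 path var sum_sq_steps_le[OF w] regret_scalar_aligned[OF T]
      in \<open>auto intro: concave_on_scalar_U convex_on_scalar_g\<close>)
qed

lemma constant_width_regret:
  fixes W :: real and s :: "nat \<Rightarrow> real" and p :: "nat \<Rightarrow> real policy"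
  assumes W: "W > 0" and X: "{-W..W} \<subseteq> X" and s: "\<forall>T. s T \<in> {-W..W}"
  shows "let A = sign_adversary W;
             Reg = (\<lambda>T. regret T (revealed_U (p T) A) (xs T) (action (p T) A)) in
         (\<forall>T. offline_solution X (s T) (revealed_U (p T) A) (revealed_g (p T) A) T (xs T)) \<longrightarrow>
           Reg \<in> \<Omega>(\<lambda>T. real T) \<and>
           ((\<forall>T. \<forall>t\<in>{1..T}. action (p T) A t \<in> {-W..W}) \<longrightarrow> Reg \<in> \<Theta>(\<lambda>T. real T))"
  unfolding Let_def
proof (intro conjI impI)
  let ?A = "sign_adversary W"
  let ?R = "\<lambda>T. regret T (revealed_U (p T) ?A) (xs T) (action (p T) ?A)"
  assume sol: "\<forall>T. offline_solution X (s T) (revealed_U (p T) ?A) (revealed_g (p T) ?A) T (xs T)"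
  have W0: "0 \<le> W" using W by simp
  have lower: "W\<^sup>2 / 2 * 1 * (real T - 4) \<le> ?R T" if "1 \<le> T" for T
    using sign_adversary_regret(1)[OF W0 X spec[OF s] that spec[OF sol]] by simp
  show omega: "?R \<in> \<Omega>(\<lambda>T. real T)"
    using bigomegaI_shifted[OF _ lower] W by simp
  assume act: "\<forall>T. \<forall>t\<in>{1..T}. action (p T) ?A t \<in> {-W..W}"
  have "?R \<in> O(\<lambda>T. real T)"
  proof (rule landau_o.bigI[of "2 * W\<^sup>2"])
    show "eventually (\<lambda>T. norm (?R T) \<le> 2 * W\<^sup>2 * norm (real T)) sequentially"
      \<comment> \<open>From \<open>T = 4\<close> on the lower bound is nonnegative, so the norm of
        the regret is the regret itself.\<close>
      using eventually_ge_at_top[of 4]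
    proof eventually_elim
      case (elim T)
      then have T: "1 \<le> T" by simp
      have "0 \<le> W\<^sup>2 / 2 * 1 * (real T - 4)" using elim by simp
      with lower[OF T] have "0 \<le> ?R T" by linarith
      moreover have "?R T \<le> 2 * W\<^sup>2 * real T"
        using sign_adversary_regret(2)[OF W0 X spec[OF s] T spec[OF sol] spec[OF act]] .
      ultimately show ?case by simp
    qed
  qed (use W in simp)
  then show "?R \<in> \<Theta>(\<lambda>T. real T)" using omega by (rule bigthetaI)
qed

text \<open>The finite-horizon bound holds for every policy and width, so it can be applied to each
  \<open>T\<close> separately with its own policy, set and start; then \<open>W\<^sup>2 * T\<close>
  is the claimed power of \<open>T\<close>.\<close>

lemma shrinking_width_regret:
  fixes \<gamma> :: real and X :: "nat \<Rightarrow> real set" and s :: "nat \<Rightarrow> real" and p :: "nat \<Rightarrow> real policy"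
  shows "let W = (\<lambda>T :: nat. real T powr (- \<gamma>)); A = (\<lambda>T. sign_adversary (W T)) in
         (\<forall>T. decision_set (X T) \<and> {- W T..W T} \<subseteq> X T \<and> s T \<in> {- W T..W T} \<and>
              offline_solution (X T) (s T) (revealed_U (p T) (A T)) (revealed_g (p T) (A T)) T (xs T)) \<longrightarrow>
           (\<lambda>T. regret T (revealed_U (p T) (A T)) (xs T) (action (p T) (A T)))
             \<in> \<Omega>(\<lambda>T. real T powr (1 - 2 * \<gamma>))"
  unfolding Let_def
proof
  let ?W = "\<lambda>T :: nat. real T powr (- \<gamma>)"
  let ?A = "\<lambda>T. sign_adversary (?W T)"
  let ?R = "\<lambda>T. regret T (revealed_U (p T) (?A T)) (xs T) (action (p T) (?A T))"
  assume H: "\<forall>T. decision_set (X T) \<and> {- ?W T..?W T} \<subseteq> X T \<and> s T \<in> {- ?W T..?W T} \<and>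
     offline_solution (X T) (s T) (revealed_U (p T) (?A T)) (revealed_g (p T) (?A T)) T (xs T)"
  have "1/2 * (?W T)\<^sup>2 * (real T - 4) \<le> ?R T" if "1 \<le> T" for T
    using sign_adversary_regret(1)[of "?W T" "X T" "s T" T "p T" "xs T"] H that by simp
  then have "?R \<in> \<Omega>(\<lambda>T. (?W T)\<^sup>2 * real T)"
    by (intro bigomegaI_shifted[where c = "1/2" and k = 4]) auto
  moreover have "eventually (\<lambda>T :: nat. (?W T)\<^sup>2 * real T = real T powr (1 - 2 * \<gamma>)) sequentially"
    using eventually_ge_at_top[of 1] by eventually_elim (rule square_powr_horizon)
  ultimately show "?R \<in> \<Omega>(\<lambda>T. real T powr (1 - 2 * \<gamma>))"
    by (simp add: landau_omega.big.cong)
qed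

text \<open>The step sizes are shared by all horizons, so the constant
  \<open>b = 2 * a 1 - 1\<close> is uniform in \<open>T\<close>. Since \<open>?M T\<close> is at
  most \<open>8 * (W T)\<^sup>2 * real T\<close>, the general bound is at most
  \<open>sqrt 8 * W T * real T\<close>, which gives the rate.\<close>

lemma shrinking_width_oga_regret:
  fixes \<gamma> :: real and a s :: "nat \<Rightarrow> real" and w x xs :: "nat \<Rightarrow> nat \<Rightarrow> real"
  assumes \<gamma>: "\<gamma> > 0" and step: "\<forall>T\<ge>1. oga_step_condition a 1 T"
  shows "let W = (\<lambda>T :: nat. real T powr (- \<gamma>)); X = (\<lambda>T. {- W T..W T});
             U = (\<lambda>T t. scalar_U (w T t)); g = (\<lambda>T (t :: nat). scalar_g (W T));
             Reg = (\<lambda>T. regret T (U T) (xs T) (x T));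
             bound = (\<lambda>T. sqrt (real T * (sq_path_length T (xs T) + sq_grad_variation (X T) T (U T)))) in
         (\<forall>T. s T \<in> X T \<and> (\<forall>t\<in>{1..T}. w T t \<in> X T) \<and>
              oga_iterates (X T) (s T) a (U T) T (x T) \<and>
              offline_solution (X T) (s T) (U T) (g T) T (xs T)) \<longrightarrow>
           (\<forall>T\<ge>1. oga_regime (X T) (U T) (g T) T 1 1 2 a (x T)) \<and>
           Reg \<in> O(bound) \<and>
           bound \<in> O(\<lambda>T. real T powr (1 - \<gamma>)) \<and>
           Reg \<in> O(\<lambda>T. real T powr (1 - \<gamma>))"
proof -
  define W where "W = (\<lambda>T :: nat. real T powr (- \<gamma>))"
  define X where "X = (\<lambda>T. {- W T..W T})"
  let ?U = "\<lambda>T t. scalar_U (w T t)" and ?g = "\<lambda>T (t :: nat). scalar_g (W T)"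
  let ?M = "\<lambda>T. sq_path_length T (xs T) + sq_grad_variation (X T) T (?U T)"
  let ?R = "\<lambda>T. regret T (?U T) (xs T) (x T)"
  let ?B = "\<lambda>T. sqrt (real T * ?M T)"
  have "(\<forall>T\<ge>1. oga_regime (X T) (?U T) (?g T) T 1 1 2 a (x T)) \<and> ?R \<in> O(?B) \<and>
      ?B \<in> O(\<lambda>T. real T powr (1 - \<gamma>)) \<and> ?R \<in> O(\<lambda>T. real T powr (1 - \<gamma>))"
    if H: "\<forall>T. s T \<in> X T \<and> (\<forall>t\<in>{1..T}. w T t \<in> X T) \<and> oga_iterates (X T) (s T) a (?U T) T (x T) \<and>
        offline_solution (X T) (s T) (?U T) (?g T) T (xs T)"
  proof -
    have s: "s T \<in> {- W T..W T}" and w: "\<forall>t\<in>{1..T}. w T t \<in> {- W T..W T}"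
      and it: "oga_iterates {- W T..W T} (s T) a (?U T) T (x T)"
      and sol: "offline_solution {- W T..W T} (s T) (?U T) (?g T) T (xs T)" for T
      using H unfolding X_def by auto
    have W0: "0 \<le> W T" for T by (simp add: W_def)
    have W1: "W T \<le> 1" if "1 \<le> T" for T
      using powr_mono[of "- \<gamma>" 0 "real T"] that \<gamma> by (simp add: W_def)
    have var: "sq_grad_variation (X T) T (?U T) = (\<Sum>t=1..<T. (w T (t + 1) - w T t)\<^sup>2)" for T
      using W0[of T] by (intro sq_grad_variation_scalar_U) (simp add: X_def)
    have xs: "xs T 1 = s T" "\<forall>t\<in>{2..T}. xs T t = w T t" if "1 \<le> T" for T
      using offline_solution_scalar_iff[OF order_refl that w s] sol by blast+
    have M: "?M T \<le> 8 * (W T)\<^sup>2 * real T" if T: "1 \<le> T" for T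
    proof -
      \<comment> \<open>The comparator follows the targets only from time 2 on; its start
        \<open>s T\<close> also lies in the interval, so the first step obeys the same
        bound.\<close>
      have "xs T t \<in> {- W T..W T}" if "t \<in> {1..T}" for t
      proof (cases "t = 1")
        case True
        then show ?thesis using xs(1)[OF T] s by simp
      next
        case False
        then have "t \<in> {2..T}" using that by auto
        then show ?thesis using xs(2)[OF T] w that by metis
      qed
      then have "sq_path_length T (xs T) \<le> 4 * (W T)\<^sup>2 * real T"
        using sum_sq_steps_le[of T "xs T" "W T"] by (simp add: sq_path_length_def)
      then show ?thesis using sum_sq_steps_le[OF w, of T] unfolding var by simp
    qed
    have M0: "0 \<le> ?M T" for T
      unfolding var by (simp add: sq_path_length_def sum_nonneg)
    define b where "b = 2 * a 1 - 1"
    have a: "1 < a t" "a t \<le> b" if "1 \<le> t" for t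
      using oga_step_condition_bounds[OF step that] by (auto simp: b_def)
    have R: "0 \<le> ?R T" "?R T \<le> 3 * b\<^sup>2 * ?M T" if T: "1 \<le> T" for T
      unfolding var
      using oga_scalar_regret[where b = b and xs = "xs T", OF it s w] a xs[OF T] T by blast+
    have regime: "\<forall>T\<ge>1. oga_regime (X T) (?U T) (?g T) T 1 1 2 a (x T)"
      using oga_regime_scalar[OF it s w W1] step unfolding X_def by blast
    have RB: "?R \<in> O(?B)"
    proof (rule bigoI[of _ "3 * b\<^sup>2 * sqrt 8"])
      show "eventually (\<lambda>T. norm (?R T) \<le> 3 * b\<^sup>2 * sqrt 8 * norm (?B T)) sequentially"
        using eventually_ge_at_top[of 1]
      proof eventually_elim
        case (elim T)
        have "(W T)\<^sup>2 \<le> 1" using W0[of T] W1[OF elim] by (simp add: power_le_one)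
        then have "8 * (W T)\<^sup>2 * real T \<le> 8 * 1 * real T"
          by (intro mult_right_mono mult_left_mono) auto
        with M[OF elim] have "?M T \<le> 8 * real T" by simp
        \<comment> \<open>Multiplying by \<open>?M T\<close> turns the linear bound on
          \<open>?M T\<close> into one by the square root of \<open>real T * ?M T\<close>.\<close>
        then have "?M T * ?M T \<le> 8 * real T * ?M T"
          using M0 by (rule mult_right_mono)
        then have "?M T \<le> sqrt (8 * (real T * ?M T))"
          by (intro real_le_rsqrt) (simp add: power2_eq_square mult.assoc)
        then have "?M T \<le> sqrt 8 * ?B T" by (simp only: real_sqrt_mult)
        then have "3 * b\<^sup>2 * ?M T \<le> 3 * b\<^sup>2 * (sqrt 8 * ?B T)" by (rule mult_left_mono) simp
        with R(2)[OF elim] have "?R T \<le> 3 * b\<^sup>2 * sqrt 8 * ?B T" by simp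
        then show ?case using R(1)[OF elim] M0[of T] by simp
      qed
    qed
    have BO: "?B \<in> O(\<lambda>T. real T powr (1 - \<gamma>))"
    proof (rule bigoI[of _ "sqrt 8"])
      show "eventually (\<lambda>T. norm (?B T) \<le> sqrt 8 * norm (real T powr (1 - \<gamma>))) sequentially"
        using eventually_ge_at_top[of 1]
      proof eventually_elim
        case (elim T)
        have "real T * ?M T \<le> real T * (8 * (W T)\<^sup>2 * real T)"
          using M[OF elim] by (rule mult_left_mono) simp
        also have "\<dots> = 8 * (W T * real T)\<^sup>2" by (simp add: power2_eq_square)
        also have "W T * real T = real T powr (1 - \<gamma>)"
          using elim powr_add[of "real T" "- \<gamma>" 1] by (simp add: W_def)
        finally have "?B T \<le> sqrt (8 * (real T powr (1 - \<gamma>))\<^sup>2)" by (rule real_sqrt_le_mono)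
        then show ?case using M0[of T] by (simp add: real_sqrt_mult)
      qed
    qed
    show ?thesis using regime RB BO landau_o.big_trans[OF RB BO] by blast
  qed
  then show ?thesis unfolding Let_def X_def W_def by blast
qed

theorem mainTheorem2:
  shows
    \<comment> \<open>There is an adversary with linear squared path length against which no policy (possibly
        tuned to the horizon) has sublinear regret.\<close>
    "(\<exists>(X :: real set) s (A :: real adversary).
        decision_set X \<and> s \<in> X \<and>
        (\<forall>h. concave_on X (fst (A h)) \<and> convex_on (X \<times> X) (\<lambda>(x, x'). snd (A h) x x')) \<and>
        (\<forall>h. \<exists>w\<in>{-1..1}. A h = (scalar_U w, scalar_g 1)) \<and>
        (\<forall>p :: nat \<Rightarrow> real policy.
           (\<forall>T. \<exists>xs. offline_solution X s (revealed_U (p T) A) (revealed_g (p T) A) T xs) \<and>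
           (\<forall>xs. (\<forall>T. offline_solution X s (revealed_U (p T) A) (revealed_g (p T) A) T (xs T)) \<longrightarrow>
              (\<lambda>T. sq_path_length T (xs T)) \<in> \<Theta>(\<lambda>T. real T) \<and>
              (\<lambda>T. regret T (revealed_U (p T) A) (xs T) (action (p T) A)) \<notin> o(\<lambda>T. real T) \<and>
              (\<lambda>T. regret T (revealed_U (p T) A) (xs T) (action (p T) A)) \<in> \<Omega>(\<lambda>T. real T))))
   \<and>
    \<comment> \<open>The scalar construction.\<close>
    (\<forall>(W :: real) X T (w :: nat \<Rightarrow> real).
        W \<ge> 0 \<longrightarrow> decision_set X \<longrightarrow> {-W..W} \<subseteq> X \<longrightarrow> 1 \<le> T \<longrightarrow> (\<forall>t\<in>{1..T}. w t \<in> {-W..W}) \<longrightarrow>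
        (let U = (\<lambda>t. scalar_U (w t)); g = (\<lambda>t :: nat. scalar_g W) in
          (\<forall>t. concave_on UNIV (U t) \<and> convex_on UNIV (\<lambda>(x, x'). g t x x'))
          \<comment> \<open>(i)\<close>
        \<and> (\<forall>x. (\<forall>t\<in>{1..T}. x t \<in> {-W..W}) \<longrightarrow> (\<forall>t\<in>{1..<T}. g t (x t) (x (t + 1)) \<le> 0))
          \<comment> \<open>(ii), where the comparator starts at \<open>w 1\<close>\<close>
        \<and> (\<forall>xs. offline_solution X (w 1) U g T xs \<longleftrightarrow> (\<forall>t\<in>{1..T}. xs t = w t))
        \<and> (\<forall>xs. offline_solution X (w 1) U g T xs \<longrightarrow>
              sq_path_length T xs = sq_grad_variation X T U \<and>
              sq_grad_variation X T U = (\<Sum>t=1..<T. (w (t + 1) - w t)\<^sup>2) \<and>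
              (\<Sum>t=1..<T. (w (t + 1) - w t)\<^sup>2) \<le> 4 * W\<^sup>2 * real T)
          \<comment> \<open>(iii)\<close>
        \<and> (\<forall>xs x. offline_solution X (w 1) U g T xs \<longrightarrow>
              regret T U xs x = 1 / 2 * (\<Sum>t=1..T. (x t - w t)\<^sup>2))
          \<comment> \<open>(iv)\<close>
        \<and> (\<forall>xs x. offline_solution X (w 1) U g T xs \<longrightarrow> (\<forall>t\<in>{1..T}. w t = - W * sign1 (x t)) \<longrightarrow>
              regret T U xs x = 1 / 2 * (\<Sum>t=1..T. (x t)\<^sup>2 + W\<^sup>2 + 2 * W * \<bar>x t\<bar>) \<and>
              regret T U xs x \<ge> W\<^sup>2 / 2 * real T)
          \<comment> \<open>(ii)-(iv) when comparator and policy share a prescribed starting point\<close>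
        \<and> (\<forall>s\<in>{-W..W}.
              (\<forall>xs. offline_solution X s U g T xs \<longleftrightarrow> xs 1 = s \<and> (\<forall>t\<in>{2..T}. xs t = w t)) \<and>
              (\<forall>xs x. offline_solution X s U g T xs \<longrightarrow> x 1 = s \<longrightarrow>
                 regret T U xs x = 1 / 2 * (\<Sum>t=2..T. (x t - w t)\<^sup>2) \<and>
                 ((\<forall>t\<in>{1..T}. w t = - W * sign1 (x t)) \<longrightarrow>
                    regret T U xs x = 1 / 2 * (\<Sum>t=2..T. (x t)\<^sup>2 + W\<^sup>2 + 2 * W * \<bar>x t\<bar>) \<and>
                    regret T U xs x \<ge> W\<^sup>2 / 2 * real (T - 1))))))
   \<and>
    \<comment> \<open>Constant \<open>W\<close>: linear regret, whatever the starting points of the comparators.\<close>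
    (\<forall>(W :: real) X (s :: nat \<Rightarrow> real) (p :: nat \<Rightarrow> real policy) xs.
        W > 0 \<longrightarrow> decision_set X \<longrightarrow> {-W..W} \<subseteq> X \<longrightarrow> (\<forall>T. s T \<in> {-W..W}) \<longrightarrow>
        (let A = sign_adversary W;
             Reg = (\<lambda>T. regret T (revealed_U (p T) A) (xs T) (action (p T) A)) in
         (\<forall>T. offline_solution X (s T) (revealed_U (p T) A) (revealed_g (p T) A) T (xs T)) \<longrightarrow>
           Reg \<in> \<Omega>(\<lambda>T. real T) \<and>
           ((\<forall>T. \<forall>t\<in>{1..T}. action (p T) A t \<in> {-W..W}) \<longrightarrow> Reg \<in> \<Theta>(\<lambda>T. real T))))
   \<and>
    \<comment> \<open>\<open>W = T\<^sup>-\<^sup>\<gamma>\<close>: lower bound for every policy.\<close>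
    (\<forall>(\<gamma> :: real) (X :: nat \<Rightarrow> real set) (s :: nat \<Rightarrow> real) (p :: nat \<Rightarrow> real policy) xs.
        \<gamma> > 0 \<longrightarrow>
        (let W = (\<lambda>T :: nat. real T powr (- \<gamma>)); A = (\<lambda>T. sign_adversary (W T)) in
         (\<forall>T. decision_set (X T) \<and> {- W T..W T} \<subseteq> X T \<and> s T \<in> {- W T..W T} \<and>
              offline_solution (X T) (s T) (revealed_U (p T) (A T)) (revealed_g (p T) (A T)) T (xs T)) \<longrightarrow>
           (\<lambda>T. regret T (revealed_U (p T) (A T)) (xs T) (action (p T) (A T)))
             \<in> \<Omega>(\<lambda>T. real T powr (1 - 2 * \<gamma>))))
   \<and>
    \<comment> \<open>\<open>W = T\<^sup>-\<^sup>\<gamma>\<close>: upper bound for online gradient ascent, whatever the adversary's choices.\<close>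
    (\<forall>(\<gamma> :: real) (a :: nat \<Rightarrow> real) (s :: nat \<Rightarrow> real) (w :: nat \<Rightarrow> nat \<Rightarrow> real) x xs.
        \<gamma> > 0 \<longrightarrow> (\<forall>T\<ge>1. oga_step_condition a 1 T) \<longrightarrow>
        (let W = (\<lambda>T :: nat. real T powr (- \<gamma>)); X = (\<lambda>T. {- W T..W T});
             U = (\<lambda>T t. scalar_U (w T t)); g = (\<lambda>T (t :: nat). scalar_g (W T));
             Reg = (\<lambda>T. regret T (U T) (xs T) (x T));
             bound = (\<lambda>T. sqrt (real T * (sq_path_length T (xs T) + sq_grad_variation (X T) T (U T)))) in
         (\<forall>T. s T \<in> X T \<and> (\<forall>t\<in>{1..T}. w T t \<in> X T) \<and>
              oga_iterates (X T) (s T) a (U T) T (x T) \<and>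
              offline_solution (X T) (s T) (U T) (g T) T (xs T)) \<longrightarrow>
           (\<forall>T\<ge>1. oga_regime (X T) (U T) (g T) T 1 1 2 a (x T)) \<and>
           Reg \<in> O(bound) \<and>
           bound \<in> O(\<lambda>T. real T powr (1 - \<gamma>)) \<and>
           Reg \<in> O(\<lambda>T. real T powr (1 - \<gamma>))))
   \<and>
    \<comment> \<open>The gap between the two rates.\<close>
    (\<forall>\<gamma> :: real. \<gamma> > 0 \<longrightarrow>
        (\<lambda>T :: nat. real T powr (1 - 2 * \<gamma>)) \<in> o(\<lambda>T. real T powr (1 - \<gamma>)))"
proof (intro conjI, goal_cases)
  case 1
  show ?case by (rule linear_regret_unavoidable)
next
  case 2
  show ?case by (intro allI impI) (rule scalar_construction)
next
  case 3
  show ?case by (intro allI impI) (rule constant_width_regret)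
next
  case 4
  show ?case by (intro allI impI) (rule shrinking_width_regret)
next
  case 5
  show ?case by (intro allI impI) (rule shrinking_width_oga_regret)
next
  case 6
  show ?case by (intro allI impI) real_asymp
qed

end
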